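(* For every integer $n>0$, the number $$a(n)= \frac{1}{2n}\sum_{k=0}^{n-1}\binom{n-1}{k}\binom{n+k}{k}\binom{2k}{k}(k+2)(-3)^{n-1-k}$$ is a positive odd integer. *)

theory Defs
  imports Complex_Main
begin

definition a :: "nat \<Rightarrow> rat" where
  "a n = 1 / (2 * of_nat n) *
     (\<Sum>k = 0..n - 1. of_nat ((n - 1) choose k) * of_nat ((n + k) choose k) *
        of_nat ((2 * k) choose k) * (of_nat k + 2) * (- 3) ^ (n - 1 - k))"

end

theory Submission
  imports Defs
begin

text \<open>
  Let \<open>T n\<close> be the central trinomial coefficient, the coefficient of \<open>x ^ n\<close> in
  \<open>(1 + x + x\<^sup>2) ^ n\<close>. The theorem follows from the closed form
  \<open>4 * a (n + 1) = (T (n + 1))\<^sup>2 + 3 * (T n)\<^sup>2\<close>: writing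
  \<open>T n = (\<Sum>k. (n choose 2k) * (2k choose k))\<close>, every summand except that of \<open>k = 0\<close> contains a
  central binomial coefficient of positive index and is even, so \<open>T n\<close> is odd; odd squares are
  \<open>1\<close> modulo \<open>8\<close>, so the right-hand side is positive and \<open>4\<close> modulo \<open>8\<close>.

  The link is that both \<open>(T n)\<^sup>2\<close> and \<open>T n * T (n + 1)\<close> are single hypergeometric sums, here called
  \<open>sq_sum n\<close> and \<open>adj_sum n\<close>; this is a Clausen-type formula for Legendre polynomials, as \<open>T n\<close> is a
  rescaled Legendre polynomial at an imaginary argument. It is proved by showing that the two sums
  satisfy the recurrences that the three-term recurrence of \<open>T\<close> forces on the products
  (\<open>adj_sum_rec\<close>, \<open>sq_sum_rec\<close>). The sum defining \<open>a\<close> is then a combination of two values of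
  \<open>sq_sum\<close> (\<open>a_eq_sq_sums\<close>).

  The summation identities either hold summand by summand or are certified by telescoping: the
  summand is the forward difference of an explicit multiple \<open>G\<close> of a hypergeometric term, found by
  Zeilberger's method. The power of \<open>k\<close> in \<open>G\<close> cancels the power of \<open>k + 1\<close> in the denominator of
  the quotient of consecutive terms and makes \<open>G 0 = 0\<close>; the remaining factor is then determined by
  comparing both sides at \<open>k = 0\<close>. The binomial coefficients are expressed through a common term by
  contiguity relations over the rationals which hold for every \<open>k\<close>, including those for which the
  coefficients vanish, so the differences need no separate treatment at the end of the range.
\<close>

section \<open>Central trinomial coefficients and the sums\<close>

definition trinom :: "nat \<Rightarrow> nat" where
  "trinom n = (\<Sum>k\<le>n. (n choose (2 * k)) * ((2 * k) choose k))"

definition trinom_term :: "nat \<Rightarrow> nat \<Rightarrow> rat" where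
  "trinom_term n k = of_nat (n choose (2 * k)) * of_nat ((2 * k) choose k)"

text \<open>
  The factor \<open>(- 3) ^ (n - k)\<close> of the classical formulas is split as \<open>(- 3) ^ n * (- 1 / 3) ^ k\<close>, which
  avoids truncated subtraction in the exponent when sums are extended beyond \<open>k = n\<close>.
\<close>

definition central_weight :: "nat \<Rightarrow> rat" where
  "central_weight k = of_nat ((2 * k) choose k) * (- 1 / 3) ^ k"

definition sq_term :: "nat \<Rightarrow> nat \<Rightarrow> rat" where
  "sq_term n k = (- 3) ^ n * (of_nat (n choose k) * of_nat ((n + k) choose k) * central_weight k)"

definition adj_term :: "nat \<Rightarrow> nat \<Rightarrow> rat" where
  "adj_term n k = (- 3) ^ n * (of_nat (n choose k) * of_nat ((Suc n + k) choose k) * central_weight k)"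

definition sq_sum :: "nat \<Rightarrow> rat" where
  "sq_sum n = (\<Sum>k\<le>n. sq_term n k)"

definition adj_sum :: "nat \<Rightarrow> rat" where
  "adj_sum n = (\<Sum>k\<le>n. adj_term n k)"

section \<open>Contiguity relations\<close>

lemma choose_Suc_lower:
  "of_nat (n choose Suc k) = (of_nat n - of_nat k) / (of_nat k + 1) * (of_nat (n choose k) :: rat)"
proof -
  have "Suc k * (n choose Suc k) + k * (n choose k) = n * (n choose k)"
  proof (cases "k \<le> n")
    case True
    then have "Suc k * (n choose Suc k) = (n - k) * (n choose k)"
      by (metis binomial_absorb_comp binomial_absorption)
    with True show ?thesis
      by (metis add_mult_distrib le_add_diff_inverse2)
  qed (simp add: binomial_eq_0)
  then have "(of_nat k + 1) * of_nat (n choose Suc k) + of_nat k * of_nat (n choose k)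
      = of_nat n * (of_nat (n choose k) :: rat)"
    by (metis of_nat_Suc of_nat_add of_nat_mult add.commute)
  then show ?thesis
    by (simp add: field_simps)
qed

lemma choose_pred_upper:
  "of_nat (n choose k) = (of_nat n + 1 - of_nat k) / (of_nat n + 1) * (of_nat (Suc n choose k) :: rat)"
proof (cases k)
  case (Suc j)
  have "(of_nat j + 1) * (of_nat (Suc n choose k)) = (of_nat n + 1) * (of_nat (n choose j) :: rat)"
    unfolding Suc by (metis Suc_times_binomial_eq of_nat_Suc of_nat_mult add.commute mult.commute)
  moreover have "of_nat (Suc n choose k) = (of_nat (n choose j) + of_nat (n choose k) :: rat)"
    by (simp add: Suc)
  ultimately have "(of_nat n + 1) * of_nat (n choose k)
      = (of_nat n - of_nat j) * (of_nat (Suc n choose k) :: rat)"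
    by algebra
  then show ?thesis
    by (simp add: Suc field_simps)
qed simp

lemma choose_diag_Suc_upper:
  "of_nat ((Suc n + k) choose k) = (of_nat n + of_nat k + 1) / (of_nat n + 1) * (of_nat ((n + k) choose k) :: rat)"
  using choose_pred_upper[of "n + k" k] by (simp add: field_simps)

lemma choose_diag_Suc_lower:
  "of_nat ((n + Suc k) choose Suc k) = (of_nat n + of_nat k + 1) / (of_nat k + 1) * (of_nat ((n + k) choose k) :: rat)"
proof -
  have "of_nat n + 1 \<noteq> (0 :: rat)"
    by (simp add: add_eq_0_iff_both_eq_0)
  moreover have "of_nat ((n + Suc k) choose Suc k) = (of_nat n + 1) / (of_nat k + 1) * (of_nat ((Suc n + k) choose k) :: rat)"
    using choose_Suc_lower[of "Suc n + k" k] by (simp del: binomial_Suc_Suc add: add.commute)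
  ultimately show ?thesis
    unfolding choose_diag_Suc_upper by simp
qed

lemma central_Suc:
  "of_nat ((2 * Suc k) choose Suc k) = 2 * (2 * of_nat k + 1) / (of_nat k + 1) * (of_nat ((2 * k) choose k) :: rat)"
proof -
  have nz: "of_nat k + 1 \<noteq> (0 :: rat)"
    by (simp add: add_eq_0_iff_both_eq_0)
  have "(of_nat k + of_nat (Suc k) + 1) / (of_nat k + 1) = (2 :: rat)"
    using nz by (simp add: divide_simps)
  then have "of_nat ((2 * Suc k) choose Suc k) = (2 :: rat) * of_nat ((k + Suc k) choose Suc k)"
    unfolding mult_2[of "Suc k"] choose_diag_Suc_upper by simp
  also have "\<dots> = 2 * ((2 * of_nat k + 1) / (of_nat k + 1) * of_nat ((2 * k) choose k))"
    unfolding choose_diag_Suc_lower mult_2 ..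
  finally show ?thesis by simp
qed

lemma central_weight_Suc:
  "central_weight (Suc k) = - (2 * (2 * of_nat k + 1) / (3 * (of_nat k + 1))) * central_weight k"
  unfolding central_weight_def central_Suc by (simp add: field_simps)

section \<open>Recurrence and parity of the central trinomial coefficients\<close>

lemma sum_telescope_zero:
  fixes G :: "nat \<Rightarrow> rat"
  assumes "\<And>k. F k = G (Suc k) - G k" "G 0 = 0" "G (Suc N) = 0"
  shows "(\<Sum>k\<le>N. F k) = 0"
  using assms by (simp add: lessThan_Suc_atMost[symmetric] sum_lessThan_telescope del: sum.lessThan_Suc)

text \<open>
  Summands beyond the natural range vanish; this and the analogous facts below bring sums of
  different index to a common range so that they can be combined termwise.
\<close>

lemma trinom_extend:
  assumes "n \<le> N"
  shows "of_nat (trinom n) = (\<Sum>k\<le>N. trinom_term n k)"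
proof -
  have "of_nat (trinom n) = (\<Sum>k\<le>n. trinom_term n k)"
    by (simp add: trinom_def trinom_term_def)
  also have "\<dots> = (\<Sum>k\<le>N. trinom_term n k)"
    by (rule sum.mono_neutral_left) (use assms in \<open>auto simp: trinom_term_def\<close>)
  finally show ?thesis .
qed

lemma trinom_rec:
  "(of_nat n + 2) * (of_nat (trinom (n + 2)) :: rat) =
     (2 * of_nat n + 3) * of_nat (trinom (n + 1)) + 3 * (of_nat n + 1) * of_nat (trinom n)"
proof -
  define G where "G k = - 4 * of_nat k ^ 2 / (of_nat n + 2) * trinom_term (n + 2) k" for k
  have "(\<Sum>k\<le>n + 2. (of_nat n + 2) * trinom_term (n + 2) k - (2 * of_nat n + 3) * trinom_term (n + 1) k
      - 3 * (of_nat n + 1) * trinom_term n k) = 0"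
  proof (rule sum_telescope_zero[where G = G])
    fix k
    define B C x y :: rat where "B = of_nat ((n + 2) choose (2 * k))"
      and "C = of_nat ((2 * k) choose k)" and "x = of_nat n" and "y = of_nat k"
    have nz: "x + 1 \<noteq> 0" "x + 2 \<noteq> 0" "y + 1 \<noteq> 0" "2 * y + 1 \<noteq> 0" "2 * y + 2 \<noteq> 0"
      unfolding x_def y_def by (simp_all add: add_eq_0_iff_both_eq_0)
    have 1: "of_nat ((n + 1) choose (2 * k)) = (x + 2 - 2 * y) / (x + 2) * B"
      using choose_pred_upper[of "n + 1" "2 * k"] by (simp add: B_def x_def y_def add.assoc add.commute)
    have 2: "of_nat (n choose (2 * k)) = (x + 1 - 2 * y) / (x + 1) * ((x + 2 - 2 * y) / (x + 2) * B)"
      using choose_pred_upper[of n "2 * k"] unfolding 1[symmetric] by (simp add: x_def y_def)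
    have 3: "of_nat ((n + 2) choose (2 * Suc k)) =
        (x + 2 - (2 * y + 1)) / (2 * y + 2) * ((x + 2 - 2 * y) / (2 * y + 1) * B)"
      using choose_Suc_lower[of "n + 2" "Suc (2 * k)"] choose_Suc_lower[of "n + 2" "2 * k"]
      by (simp add: B_def x_def y_def add.assoc add.commute)
    have 4: "G (Suc k) = - 4 * (y + 1) ^ 2 / (x + 2) * (((x + 2 - (2 * y + 1)) / (2 * y + 2) *
        ((x + 2 - 2 * y) / (2 * y + 1) * B)) * (2 * (2 * y + 1) / (y + 1) * C))"
      unfolding G_def trinom_term_def 3 central_Suc by (simp add: x_def y_def C_def add.commute)
    have 5: "G (Suc k) = - 4 * (x + 1 - 2 * y) * (x + 2 - 2 * y) / (x + 2) * (B * C)"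
    proof -
      have "2 * y + 2 = 2 * (y + 1)" by simp
      then show ?thesis unfolding 4 using nz by (simp add: power2_eq_square divide_simps) algebra
    qed
    have 6: "G k = - 4 * y ^ 2 / (x + 2) * (B * C)"
      by (simp add: G_def trinom_term_def x_def y_def B_def C_def)
    show "(of_nat n + 2) * trinom_term (n + 2) k - (2 * of_nat n + 3) * trinom_term (n + 1) k
      - 3 * (of_nat n + 1) * trinom_term n k = G (Suc k) - G k"
      unfolding trinom_term_def 5 6 1 2 B_def[symmetric] C_def[symmetric] x_def[symmetric] y_def[symmetric]
      using nz by (simp add: divide_simps) algebra
  next
    show "G (Suc (n + 2)) = 0"
      unfolding G_def trinom_term_def by (subst binomial_eq_0) simp_all
  qed (simp add: G_def)
  moreover have "of_nat (trinom m) = (\<Sum>k\<le>n + 2. trinom_term m k)" if "m \<le> n + 2" for m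
    using that by (rule trinom_extend)
  then have "of_nat (trinom n) = (\<Sum>k\<le>n + 2. trinom_term n k)"
    "of_nat (trinom (n + 1)) = (\<Sum>k\<le>n + 2. trinom_term (n + 1) k)"
    "of_nat (trinom (n + 2)) = (\<Sum>k\<le>n + 2. trinom_term (n + 2) k)"
    by simp_all
  ultimately show ?thesis
    unfolding sum_subtractf sum_distrib_left[symmetric] by algebra
qed

lemma even_central_binomial:
  fixes k :: nat
  assumes "k > 0"
  shows "even ((2 * k) choose k)"
proof -
  obtain j where j: "k = Suc j"
    using assms gr0_conv_Suc by blast
  have "Suc (2 * j) choose j = Suc (2 * j) choose (Suc (2 * j) - j)"
    by (rule binomial_symmetric) simp
  moreover have "Suc (2 * j) - j = Suc j"
    by simp
  moreover have "Suc (Suc (2 * j)) choose Suc j = (Suc (2 * j) choose j) + (Suc (2 * j) choose Suc j)"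
    by (rule binomial_Suc_Suc)
  moreover have "2 * k = Suc (Suc (2 * j))"
    by (simp add: j)
  ultimately have "(2 * k) choose k = 2 * (Suc (2 * j) choose Suc j)"
    unfolding j by (metis mult_2)
  then show ?thesis
    by (metis dvd_triv_left)
qed

lemma odd_trinom: "odd (trinom n)"
proof -
  have "even (\<Sum>k\<in>{..n} - {0}. (n choose (2 * k)) * ((2 * k) choose k))"
  proof (rule dvd_sum)
    fix k assume "k \<in> {..n} - {0}"
    then have "even ((2 * k) choose k)"
      by (intro even_central_binomial) simp
    then show "even ((n choose (2 * k)) * ((2 * k) choose k))"
      by (rule dvd_mult)
  qed
  moreover have "trinom n = 1 + (\<Sum>k\<in>{..n} - {0}. (n choose (2 * k)) * ((2 * k) choose k))"
    unfolding trinom_def by (subst sum.remove[of _ 0]) simp_all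
  ultimately show ?thesis by presburger
qed

section \<open>The squares as hypergeometric sums\<close>

lemma sq_sum_extend: "sq_sum n = (\<Sum>k\<le>N. sq_term n k)" if "n \<le> N"
  unfolding sq_sum_def
  by (rule sum.mono_neutral_left) (use that in \<open>auto simp: sq_term_def\<close>)

lemma adj_sum_extend: "adj_sum n = (\<Sum>k\<le>N. adj_term n k)" if "n \<le> N"
  unfolding adj_sum_def
  by (rule sum.mono_neutral_left) (use that in \<open>auto simp: adj_term_def\<close>)

text \<open>
  For the products of central trinomial coefficients this is the recurrence \<open>trinom_rec\<close> multiplied
  by \<open>T (n + 1)\<close>. For the sums it already holds summand by summand.
\<close>

lemma adj_sum_rec:
  "(of_nat n + 2) * adj_sum (Suc n) = (2 * of_nat n + 3) * sq_sum (Suc n) + 3 * (of_nat n + 1) * adj_sum n"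
proof -
  have "(of_nat n + 2) * adj_term (Suc n) k
    = (2 * of_nat n + 3) * sq_term (Suc n) k + 3 * (of_nat n + 1) * adj_term n k" for k
  proof -
    define B C D x y :: rat where "B = of_nat (Suc n choose k)" and "C = of_nat ((Suc n + k) choose k)"
      and "D = central_weight k * (- 3) ^ n" and "x = of_nat n" and "y = of_nat k"
    have nz: "x + 1 \<noteq> 0" "x + 2 \<noteq> 0"
      unfolding x_def by (simp_all add: add_eq_0_iff_both_eq_0)
    have 1: "of_nat (n choose k) = (x + 1 - y) / (x + 1) * B"
      using choose_pred_upper[of n k] by (simp add: B_def x_def y_def)
    have 2: "of_nat ((Suc (Suc n) + k) choose k) = (x + y + 2) / (x + 2) * C"
      using choose_diag_Suc_upper[of "Suc n" k] by (simp add: C_def x_def y_def add.assoc add.commute)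
    have "(x + 2) * (- 3 * (B * ((x + y + 2) / (x + 2) * C) * D))
      = (2 * x + 3) * (- 3 * (B * C * D)) + 3 * (x + 1) * ((x + 1 - y) / (x + 1) * B * C * D)"
      using nz by (simp add: divide_simps) algebra
    then show ?thesis
      unfolding sq_term_def adj_term_def 1 2 B_def[symmetric] C_def[symmetric] x_def[symmetric]
      unfolding D_def power_Suc by (simp only: mult_ac)
  qed
  then show ?thesis
    by (simp only: adj_sum_extend[of n "Suc n"] adj_sum_extend[of "Suc n" "Suc n"] sq_sum_extend[of "Suc n" "Suc n"]
        le_refl le_SucI sum_distrib_left sum.distrib)
qed

text \<open>
  For the products of central trinomial coefficients, \<open>trinom_rec\<close> says that
  \<open>(n + 2) * T (n + 2) - 3 * (n + 1) * T n\<close> equals \<open>(2 * n + 3) * T (n + 1)\<close>; multiplying by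
  \<open>(n + 2) * T (n + 2) + 3 * (n + 1) * T n\<close> gives a difference of squares and the recurrence below.
  This form involves no product \<open>T n * T (n + 2)\<close>, for which there is no sum at hand.
\<close>

lemma sq_sum_rec:
  "(of_nat n + 2) ^ 2 * sq_sum (n + 2) - 9 * (of_nat n + 1) ^ 2 * sq_sum n =
    (2 * of_nat n + 3) * ((of_nat n + 2) * adj_sum (Suc n) + 3 * (of_nat n + 1) * adj_sum n)"
proof -
  define x :: rat where "x = of_nat n"
  define G where "G k = - 18 * (2 * x + 3) * of_nat k ^ 3 / ((x + 1) * (x + 2)) *
     ((- 3) ^ n * (of_nat ((n + 2) choose k) * of_nat ((n + k) choose k) * central_weight k))" for k
  have "(\<Sum>k\<le>n + 2. (x + 2) ^ 2 * sq_term (n + 2) k - 9 * (x + 1) ^ 2 * sq_term n k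
      - (2 * x + 3) * ((x + 2) * adj_term (Suc n) k + 3 * (x + 1) * adj_term n k)) = 0"
  proof (rule sum_telescope_zero[where G = G])
    fix k
    define B C D y :: rat where "B = of_nat ((n + 2) choose k)" and "C = of_nat ((n + k) choose k)"
      and "D = central_weight k * (- 3) ^ n" and "y = of_nat k"
    have nz: "x + 1 \<noteq> 0" "x + 2 \<noteq> 0" "y + 1 \<noteq> 0"
      unfolding x_def y_def by (simp_all add: add_eq_0_iff_both_eq_0)
    have 1: "of_nat (Suc n choose k) = (x + 2 - y) / (x + 2) * B"
      using choose_pred_upper[of "Suc n" k] by (simp add: B_def x_def y_def add.assoc add.commute)
    have 2: "of_nat (n choose k) = (x + 1 - y) / (x + 1) * ((x + 2 - y) / (x + 2) * B)"
      using choose_pred_upper[of n k] unfolding 1[symmetric] by (simp add: x_def y_def)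
    have 3: "of_nat ((Suc n + k) choose k) = (x + y + 1) / (x + 1) * C"
      using choose_diag_Suc_upper[of n k] by (simp add: C_def x_def y_def)
    have 4: "of_nat ((n + 2 + k) choose k) = (x + y + 2) / (x + 2) * ((x + y + 1) / (x + 1) * C)"
      using choose_diag_Suc_upper[of "Suc n" k] unfolding 3[symmetric] by (simp add: x_def y_def add.assoc add.commute)
    have 5: "of_nat ((n + 2) choose Suc k) = (x + 2 - y) / (y + 1) * B"
      using choose_Suc_lower[of "n + 2" k] by (simp add: B_def x_def y_def)
    have 6: "of_nat ((n + Suc k) choose Suc k) = (x + y + 1) / (y + 1) * C"
      using choose_diag_Suc_lower[of n k] by (simp add: C_def x_def y_def)
    have 7: "G (Suc k) = - 18 * (2 * x + 3) * (y + 1) ^ 3 / ((x + 1) * (x + 2)) *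
       ((- 3) ^ n * ((x + 2 - y) / (y + 1) * B * ((x + y + 1) / (y + 1) * C) *
        (- (2 * (2 * y + 1) / (3 * (y + 1))) * central_weight k)))"
      unfolding G_def 5 6 central_weight_Suc by (simp add: y_def add.commute)
    have 8: "G (Suc k) = 12 * (2 * x + 3) * (2 * y + 1) * (x + 2 - y) * (x + y + 1) / ((x + 1) * (x + 2)) * (B * C * D)"
      unfolding 7 D_def using nz by (simp add: power3_eq_cube divide_simps) algebra
    have 9: "G k = - 18 * (2 * x + 3) * y ^ 3 / ((x + 1) * (x + 2)) * (B * C * D)"
      unfolding G_def B_def C_def D_def y_def by (simp add: mult_ac)
    have terms:
      "sq_term (n + 2) k = 9 * (x + y + 2) * (x + y + 1) / ((x + 1) * (x + 2)) * (B * C * D)"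
      "sq_term n k = (x + 1 - y) * (x + 2 - y) / ((x + 1) * (x + 2)) * (B * C * D)"
      "adj_term (Suc n) k =
         - 3 * (x + 2 - y) * (x + y + 2) * (x + y + 1) / ((x + 1) * (x + 2) ^ 2) * (B * C * D)"
      "adj_term n k = (x + 1 - y) * (x + 2 - y) * (x + y + 1) / ((x + 1) ^ 2 * (x + 2)) * (B * C * D)"
    proof -
      have u: "sq_term (n + 2) k = 9 * (B * ((x + y + 2) / (x + 2) * ((x + y + 1) / (x + 1) * C)) * D)"
        unfolding sq_term_def 4 B_def[symmetric] D_def by simp
      have v: "adj_term (Suc n) k = - 3 * ((x + 2 - y) / (x + 2) * B * ((x + y + 2) / (x + 2) * ((x + y + 1) / (x + 1) * C)) * D)"
        using 4 unfolding adj_term_def 1 D_def by simp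
      show "sq_term (n + 2) k = 9 * (x + y + 2) * (x + y + 1) / ((x + 1) * (x + 2)) * (B * C * D)"
        unfolding u using nz by (simp add: divide_simps)
      show "sq_term n k = (x + 1 - y) * (x + 2 - y) / ((x + 1) * (x + 2)) * (B * C * D)"
        unfolding sq_term_def 2 C_def[symmetric] D_def using nz by (simp add: divide_simps)
      show "adj_term (Suc n) k =
         - 3 * (x + 2 - y) * (x + y + 2) * (x + y + 1) / ((x + 1) * (x + 2) ^ 2) * (B * C * D)"
        unfolding v using nz by (simp add: divide_simps power2_eq_square) algebra
      show "adj_term n k = (x + 1 - y) * (x + 2 - y) * (x + y + 1) / ((x + 1) ^ 2 * (x + 2)) * (B * C * D)"
        unfolding adj_term_def 2 3 D_def using nz by (simp add: divide_simps power2_eq_square)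
    qed
    show "(x + 2) ^ 2 * sq_term (n + 2) k - 9 * (x + 1) ^ 2 * sq_term n k
      - (2 * x + 3) * ((x + 2) * adj_term (Suc n) k + 3 * (x + 1) * adj_term n k) = G (Suc k) - G k"
      unfolding terms 8 9 using nz by (simp add: divide_simps) algebra
  next
    show "G (Suc (n + 2)) = 0"
      unfolding G_def by (subst binomial_eq_0) simp_all
  qed (simp add: G_def)
  then show ?thesis
    unfolding sum_subtractf sum.distrib sum_distrib_left[symmetric] x_def
    by (simp only: sq_sum_extend[of n "n + 2"] sq_sum_extend[of "n + 2" "n + 2"]
        adj_sum_extend[of n "n + 2"] adj_sum_extend[of "Suc n" "n + 2"])
qed

text \<open>
  Up to the factor \<open>k + 2\<close>, the summand of \<open>a (n + 1)\<close> is that of \<open>adj_sum n\<close>, because both contain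
  \<open>(n choose k) * (n + 1 + k choose k)\<close>. Multiplying by \<open>k\<close> amounts to differentiating with respect
  to a parameter, and the derivative of a Legendre polynomial is a combination of two consecutive
  ones; this is why squares reappear.
\<close>

lemma a_eq_sq_sums:
  "4 * a (Suc n) = sq_sum (Suc n) + 3 * sq_sum n"
proof -
  define x :: rat where "x = of_nat n"
  define G where "G k = 6 * of_nat k ^ 3 / (x + 1) ^ 3 *
     ((- 3) ^ n * (of_nat (Suc n choose k) * of_nat ((n + k) choose k) * central_weight k))" for k
  have "(\<Sum>k\<le>Suc n. sq_term (Suc n) k + 3 * sq_term n k - 2 / (x + 1) * (adj_term n k * (of_nat k + 2))) = 0"
  proof (rule sum_telescope_zero[where G = G])
    fix k
    define B C D y :: rat where "B = of_nat (Suc n choose k)" and "C = of_nat ((n + k) choose k)"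
      and "D = central_weight k * (- 3) ^ n" and "y = of_nat k"
    have nz: "x + 1 \<noteq> 0" "y + 1 \<noteq> 0"
      unfolding x_def y_def by (simp_all add: add_eq_0_iff_both_eq_0)
    have 1: "of_nat (n choose k) = (x + 1 - y) / (x + 1) * B"
      using choose_pred_upper[of n k] by (simp add: x_def y_def B_def)
    have 2: "of_nat ((Suc n + k) choose k) = (x + y + 1) / (x + 1) * C"
      using choose_diag_Suc_upper[of n k] by (simp add: C_def x_def y_def)
    have 3: "of_nat (Suc n choose Suc k) = (x + 1 - y) / (y + 1) * B"
      using choose_Suc_lower[of "Suc n" k] by (simp add: B_def x_def y_def add.commute)
    have 4: "of_nat ((n + Suc k) choose Suc k) = (x + y + 1) / (y + 1) * C"
      using choose_diag_Suc_lower[of n k] by (simp add: C_def x_def y_def)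
    have 5: "G (Suc k) = 6 * (y + 1) ^ 3 / (x + 1) ^ 3 *
       ((- 3) ^ n * ((x + 1 - y) / (y + 1) * B * ((x + y + 1) / (y + 1) * C) *
        (- (2 * (2 * y + 1) / (3 * (y + 1))) * central_weight k)))"
      unfolding G_def 3 4 central_weight_Suc by (simp add: y_def add.commute)
    have 6: "G (Suc k) = - 4 * (2 * y + 1) * (x + 1 - y) * (x + y + 1) / (x + 1) ^ 3 * (B * C * D)"
      unfolding 5 D_def using nz by (simp add: power3_eq_cube divide_simps) algebra
    have 7: "G k = 6 * y ^ 3 / (x + 1) ^ 3 * (B * C * D)"
      unfolding G_def B_def C_def D_def y_def by (simp add: mult_ac)
    have "- 3 * (B * ((x + y + 1) / (x + 1) * C) * D) + 3 * ((x + 1 - y) / (x + 1) * B * C * D)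
      - 2 / (x + 1) * ((x + 1 - y) / (x + 1) * B * ((x + y + 1) / (x + 1) * C) * D * (y + 2))
      = G (Suc k) - G k"
      unfolding 6 7 using nz by (simp add: power3_eq_cube divide_simps) algebra
    then show "sq_term (Suc n) k + 3 * sq_term n k - 2 / (x + 1) * (adj_term n k * (of_nat k + 2)) = G (Suc k) - G k"
      using 1 2 by (simp add: sq_term_def adj_term_def B_def[symmetric] C_def[symmetric] D_def y_def[symmetric] mult_ac)
  next
    show "G (Suc (Suc n)) = 0"
      unfolding G_def by (subst binomial_eq_0) simp_all
  qed (simp add: G_def)
  then have "sq_sum (Suc n) + 3 * sq_sum n = 2 / (x + 1) * (\<Sum>k\<le>Suc n. adj_term n k * (of_nat k + 2))"
    unfolding sum_subtractf sum.distrib sum_distrib_left[symmetric]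
    by (simp only: sq_sum_extend[of n "Suc n"] sq_sum_extend[of "Suc n" "Suc n"])
  also have "(\<Sum>k\<le>Suc n. adj_term n k * (of_nat k + 2)) = (\<Sum>k\<le>n. adj_term n k * (of_nat k + 2))"
    by (simp add: adj_term_def binomial_eq_0)
  also have "\<dots> = (\<Sum>k = 0..n. of_nat (n choose k) * of_nat ((Suc n + k) choose k) *
        of_nat ((2 * k) choose k) * (of_nat k + 2) * (- 3) ^ (n - k))"
    unfolding atMost_atLeast0
  proof (rule sum.cong)
    fix k assume "k \<in> {0..n}"
    then have "(- 3 :: rat) ^ n = (- 3) ^ (n - k) * (- 3) ^ k"
      by (simp flip: power_add)
    then have *: "(- 3 :: rat) ^ n * (- 1 / 3) ^ k = (- 3) ^ (n - k)"
      by (simp add: mult.assoc flip: power_mult_distrib)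
    then show "adj_term n k * (of_nat k + 2) = of_nat (n choose k) * of_nat ((Suc n + k) choose k) *
        of_nat ((2 * k) choose k) * (of_nat k + 2) * (- 3) ^ (n - k)"
      unfolding adj_term_def central_weight_def * [symmetric] by (simp only: mult_ac)
  qed simp
  also have "2 / (x + 1) = 4 * (1 / (2 * of_nat (Suc n)))"
    by (simp add: x_def divide_simps)
  also note mult.assoc
  also have "1 / (2 * of_nat (Suc n)) * (\<Sum>k = 0..n. of_nat (n choose k) * of_nat ((Suc n + k) choose k) *
        of_nat ((2 * k) choose k) * (of_nat k + 2) * (- 3) ^ (n - k)) = a (Suc n)"
    unfolding a_def by (simp only: diff_Suc_1)
  finally show ?thesis ..
qed

text \<open>
  The three claims are proved together: by the two recurrences, \<open>adj_sum (n + 1)\<close> depends on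
  \<open>sq_sum (n + 1)\<close> and \<open>adj_sum n\<close>, and then \<open>sq_sum (n + 2)\<close> on \<open>sq_sum n\<close> and two values of
  \<open>adj_sum\<close>.
\<close>

lemma sums_eq_trinom_products:
  "sq_sum n = of_nat (trinom n) ^ 2
   \<and> sq_sum (Suc n) = of_nat (trinom (Suc n)) ^ 2
   \<and> adj_sum n = of_nat (trinom n) * of_nat (trinom (Suc n))"
proof (induction n)
  case 0
  show ?case
    by (simp add: sq_sum_def adj_sum_def sq_term_def adj_term_def trinom_def central_weight_def binomial_eq_0)
next
  case (Suc n)
  define x t0 t1 t2 :: rat where "x = of_nat n" and "t0 = of_nat (trinom n)"
    and "t1 = of_nat (trinom (Suc n))" and "t2 = of_nat (trinom (n + 2))"
  have nz: "x + 2 \<noteq> 0"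
    unfolding x_def by (simp add: add_eq_0_iff_both_eq_0)
  have IH: "sq_sum n = t0 ^ 2" "sq_sum (Suc n) = t1 ^ 2" "adj_sum n = t0 * t1"
    using Suc.IH by (simp_all add: t0_def t1_def)
  have rec: "(x + 2) * t2 = (2 * x + 3) * t1 + 3 * (x + 1) * t0"
    using trinom_rec[of n] by (simp add: x_def t0_def t1_def t2_def)
  have "(x + 2) * adj_sum (Suc n) = (2 * x + 3) * t1 ^ 2 + 3 * (x + 1) * (t0 * t1)"
    using adj_sum_rec[of n] unfolding IH x_def .
  also have "\<dots> = (x + 2) * (t1 * t2)"
    using rec by algebra
  finally have adj: "adj_sum (Suc n) = t1 * t2"
    using nz by simp
  have "(x + 2) ^ 2 * sq_sum (n + 2) - 9 * (x + 1) ^ 2 * t0 ^ 2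
      = (2 * x + 3) * ((x + 2) * (t1 * t2) + 3 * (x + 1) * (t0 * t1))"
    using sq_sum_rec[of n] unfolding IH adj x_def .
  then have "(x + 2) ^ 2 * sq_sum (n + 2) = (x + 2) ^ 2 * t2 ^ 2"
    using rec by algebra
  then have "sq_sum (n + 2) = t2 ^ 2"
    using nz by simp
  with IH adj show ?case
    by (simp add: t1_def t2_def)
qed

theorem mainTheorem5:
  fixes n :: nat
  assumes "n > 0"
  shows "\<exists>m :: int. a n = of_int m \<and> m > 0 \<and> odd m"
proof -
  obtain j where n: "n = Suc j"
    using assms by (cases n) auto
  obtain r s where r: "trinom (Suc j) = 2 * r + 1" and s: "trinom j = 2 * s + 1"
    using odd_trinom by (meson oddE)
  \<comment> \<open>\<open>(2 * r + 1)\<^sup>2 + 3 * (2 * s + 1)\<^sup>2\<close> divided by \<open>4\<close>; products of consecutive numbers are even.\<close>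
  define m where "m = int (r * (r + 1) + 3 * (s * (s + 1)) + 1)"
  have "4 * a n = of_nat (trinom (Suc j)) ^ 2 + 3 * of_nat (trinom j) ^ 2"
    unfolding n a_eq_sq_sums using sums_eq_trinom_products[of j] by simp
  also have "\<dots> = 4 * of_int m"
    unfolding r s m_def by (simp add: power2_eq_square algebra_simps)
  finally have "a n = of_int m"
    by simp
  moreover have "m > 0"
    unfolding m_def of_nat_0_less_iff by simp
  moreover have "odd m"
    unfolding m_def by simp
  ultimately show ?thesis
    by blast
qed

end
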